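(* Assume $\mathbb{E}\left[\|\bm{x}_0\|^2\right]=\gamma$. For any given received noisy latent feature map $\bm{y}=\eta\bm{z}+\bm{n}$ and noise density $\sigma^2$ of the noisy channel, when $$t=\frac{2+\phi-\sqrt{\phi^2+4\phi}}{2},\qquad\text{where}\quad \phi=\frac{\mathbb{E}[\|\bm{y}\|_2^2]-\sigma^2}{\gamma\sigma^2},$$ the following equation holds: $$\frac{\mathbb{E}\left[\|\eta\bm{z}\|_2^2\right]}{\mathbb{E}\left[\|\bm{n}\|_2^2\right]}=\frac{\mathbb{E}\left[\|(1-t)\bm{x}_0\|^2\right]}{\mathbb{E}\left[\|\sqrt{t}\,\bm{\epsilon}\|_2^2\right]}.$$
   Context: All vectors lie in $\mathbb{R}^d$, and $\|\cdot\|$ and $\|\cdot\|_2$ both denote the Euclidean norm. A latent vector $\bm{z}\in\mathbb{R}^d$ (the encoder's semantic representation of the source data) is sent over a fading channel with additive Gaussian noise, and the receiver observes $\bm{y}=\eta\bm{z}+\bm{n}$, where $\eta$ is the signal power attenuation factor caused by channel fading and $\bm{n}\sim\mathcal{N}(\bm{0},\sigma^2\bm{I})$ is the channel noise, with $\sigma^2$ the channel noise power (called the noise density in the claim). The random vector $\bm{x}_0$ is the clean data sample of a diffusion model whose forward process is $\bm{x}_t=(1-t)\bm{x}_0+\sqrt{t}\,\bm{\epsilon}$ with $\bm{\epsilon}\sim\mathcal{N}(\bm{0},\bm{I})$ and timestep $t\in(0,1]$. The identity says that the signal-to-noise energy ratio of the received vector $\bm{y}$ equals that of the diffusion variable $\bm{x}_t$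 at the chosen timestep $t$.
   Formalization: In φ the subtracted σ² is replaced by dσ² (= E‖n‖²), since the printed formula fails for every d ≥ 2 (e.g. d = 2, z = 0 gives 0 = 1/2); n is assumed independent of ηz, E‖ηz‖² and E‖x₀‖² finite, and σ, γ > 0. *)

theory Defs
  imports "HOL-Probability.Probability"
begin

(* Density of N(mu, s^2 I) on R^d with respect to Lebesgue measure. As for normal_density,
   the parameter s is the standard deviation, not the variance. *)
definition isotropic_normal_density :: "real ^ 'd \<Rightarrow> real \<Rightarrow> real ^ 'd \<Rightarrow> real" where
  "isotropic_normal_density \<mu> s x = (\<Prod>i\<in>UNIV. normal_density (\<mu> $ i) s (x $ i))"

(* If n ~ N(0, s^2 I) on R^d, then E |n|^2 = d * s^2. With the Euclidean norm, the noise energy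
   to be subtracted from E |y|^2 in the signal-to-noise parameter phi is therefore d * s^2. It
   is s^2 only for d = 1, or if energies are measured per component. *)

end

theory Submission imports Defs
begin

text \<open>Independence and the zero mean of the noise kill the cross term of \<open>\<parallel>\<eta> z + n\<parallel>\<^sup>2\<close>, so
  \<open>\<phi>\<close> is the signal energy divided by \<open>\<gamma> \<sigma>\<^sup>2\<close>. The given \<open>t\<close> is the smaller root of
  \<open>(1 - t)\<^sup>2 = \<phi> t\<close>, which is positive because the product of the roots is \<open>1\<close>.\<close>

text \<open>On a probability space L2 is contained in L1. This lets the energies, which are assumed
  finite, supply the existence of the vector-valued means.\<close>

lemma (in prob_space) square_integrable_norm_imp_integrable:
  fixes X :: "'a \<Rightarrow> 'b::{banach, second_countable_topology}"
  assumes [measurable]: "X \<in> borel_measurable M"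
    and int: "integrable M (\<lambda>\<omega>. (norm (X \<omega>))\<^sup>2)"
  shows "integrable M X"
proof -
  have "integrable M (\<lambda>\<omega>. norm (X \<omega>))"
    by (rule square_integrable_imp_integrable) (use int in simp_all)
  then show ?thesis by (rule integrable_norm_cancel) simp
qed

text \<open>In an orthonormal basis the inner product is a finite sum of products of coordinates.
  Coordinates of independent vectors are independent, so the real product rule applies to each
  summand and first moments suffice.\<close>

lemma (in prob_space) indep_var_integrable_inner:
  fixes X Y :: "'a \<Rightarrow> 'b::euclidean_space"
  assumes ind: "indep_var borel X borel Y" and X: "integrable M X" and Y: "integrable M Y"
  shows "integrable M (\<lambda>\<omega>. X \<omega> \<bullet> Y \<omega>)"
    and "expectation (\<lambda>\<omega>. X \<omega> \<bullet> Y \<omega>) = expectation X \<bullet> expectation Y"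
proof -
  have ind_b: "indep_var borel (\<lambda>\<omega>. X \<omega> \<bullet> b) borel (\<lambda>\<omega>. Y \<omega> \<bullet> b)" for b
    using indep_var_compose[OF ind, of "\<lambda>v. v \<bullet> b" borel "\<lambda>v. v \<bullet> b" borel] by (simp add: o_def)
  have int_b: "integrable M (\<lambda>\<omega>. X \<omega> \<bullet> b)" "integrable M (\<lambda>\<omega>. Y \<omega> \<bullet> b)" for b
    using X Y by simp_all
  have prod_b: "integrable M (\<lambda>\<omega>. (X \<omega> \<bullet> b) * (Y \<omega> \<bullet> b))" for b
    by (rule indep_var_integrable[OF ind_b int_b])
  show "integrable M (\<lambda>\<omega>. X \<omega> \<bullet> Y \<omega>)"
    by (subst euclidean_inner) (intro Bochner_Integration.integrable_sum prod_b)
  have "expectation (\<lambda>\<omega>. X \<omega> \<bullet> Y \<omega>) = (\<Sum>b\<in>Basis. expectation (\<lambda>\<omega>. (X \<omega> \<bullet> b) * (Y \<omega> \<bullet> b)))"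
    by (subst euclidean_inner) (intro Bochner_Integration.integral_sum prod_b)
  also have "\<dots> = (\<Sum>b\<in>Basis. (expectation X \<bullet> b) * (expectation Y \<bullet> b))"
    using X Y by (simp add: indep_var_lebesgue_integral[OF ind_b int_b])
  also have "\<dots> = expectation X \<bullet> expectation Y"
    by (rule euclidean_inner[symmetric])
  finally show "expectation (\<lambda>\<omega>. X \<omega> \<bullet> Y \<omega>) = expectation X \<bullet> expectation Y" .
qed

text \<open>Expanding the square leaves twice the expected inner product, which factors by
  independence and vanishes with the mean of \<open>Y\<close>. The mean of \<open>X\<close>, here
  the signal, is arbitrary.\<close>

lemma (in prob_space) expectation_norm_add_indep:
  fixes X Y :: "'a \<Rightarrow> 'b::euclidean_space"
  assumes ind: "indep_var borel X borel Y"
    and X2: "integrable M (\<lambda>\<omega>. (norm (X \<omega>))\<^sup>2)" and Y2: "integrable M (\<lambda>\<omega>. (norm (Y \<omega>))\<^sup>2)"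
    and mean: "expectation Y = 0"
  shows "expectation (\<lambda>\<omega>. (norm (X \<omega> + Y \<omega>))\<^sup>2)
       = expectation (\<lambda>\<omega>. (norm (X \<omega>))\<^sup>2) + expectation (\<lambda>\<omega>. (norm (Y \<omega>))\<^sup>2)"
proof -
  have "X \<in> borel_measurable M" "Y \<in> borel_measurable M"
    using indep_var_rv1[OF ind] indep_var_rv2[OF ind] by simp_all
  then have X: "integrable M X" and Y: "integrable M Y"
    using X2 Y2 by (auto intro: square_integrable_norm_imp_integrable)
  have "(norm (X \<omega> + Y \<omega>))\<^sup>2 = (norm (X \<omega>))\<^sup>2 + (norm (Y \<omega>))\<^sup>2 + 2 * (X \<omega> \<bullet> Y \<omega>)" for \<omega>
    by (simp add: power2_norm_eq_inner inner_simps inner_commute)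
  then show ?thesis
    using indep_var_integrable_inner[OF ind X Y] X2 Y2 mean by simp
qed

text \<open>Rewrites the product over indices as one over \<open>Basis\<close>, the form in which
  Tonelli's theorem for \<open>lborel\<close> is stated.\<close>

lemma isotropic_normal_density_Basis:
  fixes \<mu> x :: "real ^ 'd"
  shows "isotropic_normal_density \<mu> s x = (\<Prod>b\<in>Basis. normal_density (\<mu> \<bullet> b) s (x \<bullet> b))"
proof -
  have Basis: "(Basis :: (real ^ 'd) set) = range (\<lambda>i. axis i 1)"
    by (auto simp: Basis_vec_def)
  have "inj (\<lambda>i::'d. axis i (1::real))"
    by (auto simp: inj_def axis_eq_axis)
  then show ?thesis
    unfolding Basis by (simp add: isotropic_normal_density_def prod.reindex inner_axis)
qed

text \<open>The joint density is a product, so integrating out every coordinate except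
  \<open>i\<close> leaves the one-dimensional normal density as the marginal.\<close>

lemma isotropic_normal_component:
  fixes X :: "'a \<Rightarrow> real ^ 'd"
  assumes s: "s > 0" and D: "distributed M lborel X (isotropic_normal_density \<mu> s)"
  shows "distributed M lborel (\<lambda>\<omega>. X \<omega> $ i) (normal_density (\<mu> $ i) s)"
proof -
  define c :: "real ^ 'd" where "c = axis i 1"
  have c: "c \<in> Basis" and nth: "v $ i = v \<bullet> c" for v :: "real ^ 'd"
    by (auto simp: c_def cart_eq_inner_axis)
  have X [measurable]: "X \<in> borel_measurable M"
    using distributed_measurable[OF D] by simp
  have "emeasure (distr M lborel (\<lambda>\<omega>. X \<omega> $ i)) A
      = emeasure (density lborel (normal_density (\<mu> $ i) s)) A" if A: "A \<in> sets lborel" for A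
  proof -
    have [measurable]: "A \<in> sets borel" using A by simp
    \<comment> \<open>The indicator of \<open>A\<close> is absorbed into the factor for the
      direction \<open>c\<close>, so that the integrand remains a product of one-variable
      functions.\<close>
    define f :: "real ^ 'd \<Rightarrow> real \<Rightarrow> ennreal" where
      "f b r = ennreal (normal_density (\<mu> \<bullet> b) s r) * (if b = c then indicator A r else 1)" for b r
    have [measurable]: "f b \<in> borel_measurable borel" for b
      unfolding f_def by (cases "b = c") simp_all
    have dens: "ennreal (isotropic_normal_density \<mu> s x) * indicator A (x \<bullet> c)
        = (\<Prod>b\<in>Basis. f b (x \<bullet> b))" for x
      using c by (simp add: f_def isotropic_normal_density_Basis prod.distrib prod.delta prod_ennreal)
    have one: "(\<integral>\<^sup>+r. f b r \<partial>lborel) = 1" if "b \<noteq> c" for b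
      using s that by (simp add: f_def nn_integral_eq_integral)
    have "emeasure (distr M lborel (\<lambda>\<omega>. X \<omega> $ i)) A = (\<integral>\<^sup>+\<omega>. indicator A (X \<omega> \<bullet> c) \<partial>M)"
      by (simp add: nth nn_integral_indicator[symmetric] nn_integral_distr del: nn_integral_indicator)
    also have "\<dots> = (\<integral>\<^sup>+x. ennreal (isotropic_normal_density \<mu> s x) * indicator A (x \<bullet> c) \<partial>lborel)"
      by (rule distributed_nn_integral[OF D, symmetric]) simp
    \<comment> \<open>Tonelli: the integral of the product splits. All factors except the one for
      \<open>c\<close> are total masses of normal densities, hence 1.\<close>
    also have "\<dots> = (\<Prod>b\<in>Basis. \<integral>\<^sup>+r. f b r \<partial>lborel)"
      unfolding dens by (rule nn_integral_lborel_prod) simp_all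
    also have "\<dots> = (\<integral>\<^sup>+r. f c r \<partial>lborel)"
      using c by (subst prod.remove[of _ c]) (simp_all add: one)
    also have "\<dots> = emeasure (density lborel (normal_density (\<mu> $ i) s)) A"
      by (simp add: f_def nth emeasure_density)
    finally show ?thesis .
  qed
  then have "distr M lborel (\<lambda>\<omega>. X \<omega> $ i) = density lborel (normal_density (\<mu> $ i) s)"
    by (intro measure_eqI) simp_all
  then show ?thesis
    by (simp add: distributed_def nth)
qed

text \<open>Everything reduces to the coordinates, each normal with mean 0 and variance
  \<open>s\<^sup>2\<close>; the energy is the sum of these variances, one per dimension.\<close>

lemma (in prob_space) isotropic_normal_moments:
  fixes X :: "'a \<Rightarrow> real ^ 'd"
  assumes s: "s > 0" and D: "distributed M lborel X (isotropic_normal_density 0 s)"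
  shows isotropic_normal_integrable_square: "integrable M (\<lambda>\<omega>. (norm (X \<omega>))\<^sup>2)"
    and isotropic_normal_expectation_square: "expectation (\<lambda>\<omega>. (norm (X \<omega>))\<^sup>2) = real CARD('d) * s\<^sup>2"
    and isotropic_normal_expectation: "expectation X = 0"
proof -
  have X: "X \<in> borel_measurable M"
    using distributed_measurable[OF D] by simp
  have comp: "distributed M lborel (\<lambda>\<omega>. X \<omega> $ i) (normal_density 0 s)" for i
    using isotropic_normal_component[OF s D] by simp
  have norm_sq: "(norm v)\<^sup>2 = (\<Sum>i\<in>UNIV. (v $ i)\<^sup>2)" for v :: "real ^ 'd"
    unfolding power2_norm_eq_inner by (simp add: inner_vec_def power2_eq_square)
  have sq: "integrable M (\<lambda>\<omega>. (X \<omega> $ i)\<^sup>2)" for i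
    using distributed_integrable[OF comp, of "\<lambda>r. r\<^sup>2"] integrable_normal_moment[OF s, of 0 2] by simp
  have mean: "expectation (\<lambda>\<omega>. X \<omega> $ i) = 0" for i
    using normal_distributed_expectation[OF s comp] by simp
  have var: "expectation (\<lambda>\<omega>. (X \<omega> $ i)\<^sup>2) = s\<^sup>2" for i
    using normal_distributed_variance[OF s comp] by (simp add: mean)
  show int: "integrable M (\<lambda>\<omega>. (norm (X \<omega>))\<^sup>2)"
    unfolding norm_sq by (intro Bochner_Integration.integrable_sum sq)
  show "expectation (\<lambda>\<omega>. (norm (X \<omega>))\<^sup>2) = real CARD('d) * s\<^sup>2"
    unfolding norm_sq by (simp add: Bochner_Integration.integral_sum sq var)
  have "integrable M X"
    by (rule square_integrable_norm_imp_integrable[OF X int])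
  \<comment> \<open>Taking a coordinate is bounded and linear, so it commutes with the integral once
    \<open>X\<close> itself is integrable.\<close>
  then have "expectation X $ i = expectation (\<lambda>\<omega>. X \<omega> $ i)" for i
    by (simp add: cart_eq_inner_axis)
  then show "expectation X = 0"
    by (simp add: vec_eq_iff mean)
qed

text \<open>Positivity of \<open>t\<close> serves to give \<open>sqrt t\<close> the square
  \<open>t\<close> and to allow cancelling \<open>t\<close>; the equation turns the diffusion signal
  energy into a multiple of \<phi>.\<close>

lemma matched_timestep:
  fixes \<phi> t :: real
  assumes "\<phi> \<ge> 0" and t: "t = (2 + \<phi> - sqrt (\<phi>\<^sup>2 + 4 * \<phi>)) / 2"
  shows "t > 0" and "(1 - t)\<^sup>2 = \<phi> * t"
proof -
  define r where "r = sqrt (\<phi>\<^sup>2 + 4 * \<phi>)"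
  have r: "r\<^sup>2 = \<phi>\<^sup>2 + 4 * \<phi>" using assms(1) by (simp add: r_def)
  \<comment> \<open>The two squares differ by exactly 4.\<close>
  have "r\<^sup>2 < (2 + \<phi>)\<^sup>2" unfolding r by (simp add: power2_eq_square algebra_simps)
  then have "r < 2 + \<phi>" by (rule power2_less_imp_less) (use assms(1) in simp)
  then show "t > 0" by (simp add: t r_def)
  \<comment> \<open>Here \<open>1 - t = (r - \<phi>) / 2\<close>; after squaring, the value of
    \<open>r\<^sup>2\<close> makes a factor \<phi> split off.\<close>
  show "(1 - t)\<^sup>2 = \<phi> * t"
    using r unfolding t r_def[symmetric] by (simp add: power2_eq_square field_simps)
qed

text \<open>Fading may be random: \<eta> is a function on the sample space, and independence from
  the noise is imposed on the product of \<eta> and \<open>z\<close>. The energy subtracted in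
  \<phi> carries the dimension factor, so that it equals the full noise energy.\<close>

theorem theorem1:
  fixes M :: "'w measure"
    and \<eta> :: "'w \<Rightarrow> real"
    and z n y x\<^sub>0 \<epsilon> :: "'w \<Rightarrow> real ^ 'd"
    and \<sigma> \<gamma> \<phi> t :: real
  assumes "prob_space M"
    and "\<sigma> > 0" and "\<gamma> > 0"
    and "\<eta> \<in> borel_measurable M" and "z \<in> borel_measurable M"
    and "integrable M (\<lambda>\<omega>. (norm (\<eta> \<omega> *\<^sub>R z \<omega>))\<^sup>2)"
    and "distributed M lborel n (isotropic_normal_density 0 \<sigma>)"
    and "prob_space.indep_var M borel (\<lambda>\<omega>. \<eta> \<omega> *\<^sub>R z \<omega>) borel n"
    and "\<And>\<omega>. y \<omega> = \<eta> \<omega> *\<^sub>R z \<omega> + n \<omega>"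
    and "x\<^sub>0 \<in> borel_measurable M"
    and "integrable M (\<lambda>\<omega>. (norm (x\<^sub>0 \<omega>))\<^sup>2)"
    and "prob_space.expectation M (\<lambda>\<omega>. (norm (x\<^sub>0 \<omega>))\<^sup>2) = \<gamma>"
    and "distributed M lborel \<epsilon> (isotropic_normal_density 0 1)"
    and "\<phi> = (prob_space.expectation M (\<lambda>\<omega>. (norm (y \<omega>))\<^sup>2) - real CARD('d) * \<sigma>\<^sup>2) / (\<gamma> * \<sigma>\<^sup>2)"
    and "t = (2 + \<phi> - sqrt (\<phi>\<^sup>2 + 4 * \<phi>)) / 2"
  shows "prob_space.expectation M (\<lambda>\<omega>. (norm (\<eta> \<omega> *\<^sub>R z \<omega>))\<^sup>2)
           / prob_space.expectation M (\<lambda>\<omega>. (norm (n \<omega>))\<^sup>2)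
       = prob_space.expectation M (\<lambda>\<omega>. (norm ((1 - t) *\<^sub>R x\<^sub>0 \<omega>))\<^sup>2)
           / prob_space.expectation M (\<lambda>\<omega>. (norm (sqrt t *\<^sub>R \<epsilon> \<omega>))\<^sup>2)"
proof -
  interpret prob_space M by fact
  define P where "P = expectation (\<lambda>\<omega>. (norm (\<eta> \<omega> *\<^sub>R z \<omega>))\<^sup>2)"
  define d where "d = real CARD('d)"
  have "P \<ge> 0" by (simp add: P_def)
  have "d > 0" by (simp add: d_def)
  have noise: "expectation (\<lambda>\<omega>. (norm (n \<omega>))\<^sup>2) = d * \<sigma>\<^sup>2"
    unfolding d_def by (rule isotropic_normal_expectation_square) fact+
  have "expectation (\<lambda>\<omega>. (norm (y \<omega>))\<^sup>2) = P + d * \<sigma>\<^sup>2"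
    unfolding assms(9) noise[symmetric] P_def
    by (rule expectation_norm_add_indep[OF assms(8) assms(6)
          isotropic_normal_integrable_square[OF assms(2,7)] isotropic_normal_expectation[OF assms(2,7)]])
  \<comment> \<open>The noise energy contained in \<open>y\<close> cancels against the one
    subtracted in \<phi>.\<close>
  then have \<phi>: "\<phi> = P / (\<gamma> * \<sigma>\<^sup>2)"
    using assms(14) by (simp add: d_def)
  then have "\<phi> \<ge> 0"
    using \<open>P \<ge> 0\<close> \<open>\<gamma> > 0\<close> by simp
  note t = matched_timestep[OF this assms(15)]
  have signal: "expectation (\<lambda>\<omega>. (norm ((1 - t) *\<^sub>R x\<^sub>0 \<omega>))\<^sup>2) = \<phi> * t * \<gamma>"
    using assms(12) by (simp add: power_mult_distrib t(2))
  have "expectation (\<lambda>\<omega>. (norm (\<epsilon> \<omega>))\<^sup>2) = d"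
    using isotropic_normal_expectation_square[OF _ assms(13)] by (simp add: d_def)
  then have diffusion: "expectation (\<lambda>\<omega>. (norm (sqrt t *\<^sub>R \<epsilon> \<omega>))\<^sup>2) = t * d"
    using t(1) by (simp add: power_mult_distrib)
  \<comment> \<open>Both sides equal \<open>\<phi> * \<gamma> / d\<close>: on the left because
    \<open>P = \<phi> * \<gamma> * \<sigma>\<^sup>2\<close>, on the right by cancelling
    \<open>t\<close>.\<close>
  have "P / (d * \<sigma>\<^sup>2) = \<phi> * t * \<gamma> / (t * d)"
    using t(1) \<open>d > 0\<close> \<open>\<gamma> > 0\<close> \<open>\<sigma> > 0\<close> by (simp add: \<phi> field_simps)
  then show ?thesis
    unfolding noise signal diffusion P_def .
qed

end
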